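(* In the vertical model described in the context, the one-step-ahead policy has an expected total reward at least as high as that of the greedy policy: from any initial state $(\mathbf x,\mathbf y)$ in period $1$, the expected total reward over periods $1,\dots,T$ under the one-step-ahead policy is greater than or equal to the expected total reward under the greedy policy.
   Context: Model. $T,m,n\ge1$ are integers, $\alpha,\beta\in[0,1]$, demand types $\mathcal D=\{1,\dots,m\}$, supply types $\mathcal S=\{1,\dots,n\}$, unit matching rewards $r_{ij}^t$ ($1\le t\le T$). In each period $t$ random vectors $\mathbf D^t\in\mathbb R_+^m,\mathbf S^t\in\mathbb R_+^n$ arrive; their distributions do not depend on matching decisions and have finite expectations. The state $(\mathbf x,\mathbf y)\in\mathbb R_+^m\times\mathbb R_+^n$ in period $t$ lists available quantities after the arrivals of period $t$. A feasible decision is $\mathbf Q=(q_{ij})\in\mathbb R_+^{m\times n}$ with $u_i=x_i-\sum_jq_{ij}\ge0$, $v_j=y_j-\sum_iq_{ij}\ge0$; it earns $\sum_{i,j}r_{ij}^tq_{ij}$ in period $t$ and the next state is $(\alpha\mathbf u+\mathbf D^{t+1},\beta\mathbf v+\mathbf S^{t+1})$. The expected total reward $W_t^\pi(\mathbf x,\mathbf y)$ of a policy $\pi$ from period $t$ on is defined by $W_{T+1}^\pi\equiv0$ and $W_t^\pi(\mathbf x,\mathbf y)=\sum_{i,j}r_{ij}^tq_{ij}+E\,W_{t+1}^\pi(\alpha\mathbf u+\mathbf D^{t+1},\beta\mathbf v+\mathbf S^{t+1})$, with $\mathbf Q$ the decision of $\pi$ in period $t$ and state $(\mathbf x,\mathbf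 y)$. Vertical model. $r_{ij}^t=r_{id}^t+r_{js}^t$ with $r_{1d}^t>\dots>r_{md}^t$, $r_{1s}^t>\dots>r_{ns}^t$, $r_{m+1,d}^t=r_{n+1,s}^t=0$; for $t=1,\dots,T-1$ and all $i\le m$, $j\le n$: $r_{id}^t-r_{i+1,d}^t\ge\alpha(r_{id}^{t+1}-r_{i+1,d}^{t+1})$ and $r_{js}^t-r_{j+1,s}^t\ge\beta(r_{js}^{t+1}-r_{j+1,s}^{t+1})$. Greedy policy. With $\tilde x_i=\sum_{k\le i}x_k$, $\tilde y_j=\sum_{k\le j}y_k$, $\tilde x_0=\tilde y_0=0$, the greedy policy matches as much as possible from the top down: $q_{ij}=(\min\{\tilde x_i,\tilde y_j\}-\max\{\tilde x_{i-1},\tilde y_{j-1}\})^+$. Let $V_t^g(\mathbf x,\mathbf y)$ be its expected total reward from period $t$ to $T$, with $V^g_{T+1}\equiv0$. One-step-ahead policy. In each period $t$ and state $(\mathbf x,\mathbf y)$ it uses a feasible decision maximizing $\sum_{i,j}r_{ij}^tq_{ij}+E\,V_{t+1}^g(\alpha\mathbf u+\mathbf D^{t+1},\beta\mathbf v+\mathbf S^{t+1})$, i.e. it acts as if the greedy policy were used from period $t+1$ on. *)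

theory Defs
  imports "HOL-Probability.Probability"
begin

text \<open>
  Demand types, supply types and periods are natural numbers starting at 1.
  A vector in \<open>\<real>\<^sub>+\<^sup>k\<close> is an extensional function on \<open>{1..k}\<close>, so that the carrier of
  \<open>orthant k\<close> is exactly \<open>\<real>\<^sub>+\<^sup>k\<close>.
\<close>

definition orthant :: "nat \<Rightarrow> (nat \<Rightarrow> real) measure" where
  "orthant k = (\<Pi>\<^sub>M i\<in>{1..k}. restrict_space borel {0..})"

lemma space_orthant: "space (orthant k) = (\<Pi>\<^sub>E i\<in>{1..k}. {0..})"
  by (simp add: orthant_def space_PiM space_restrict_space)

type_synonym state = "(nat \<Rightarrow> real) \<times> (nat \<Rightarrow> real)"

text \<open>Only the entries of a decision with indices in \<open>{1..m} \<times> {1..n}\<close> are ever used.\<close>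

type_synonym decision = "nat \<Rightarrow> nat \<Rightarrow> real"

type_synonym policy = "nat \<Rightarrow> state \<Rightarrow> decision"

record 'w matching_model =
  horizon :: nat
  n_demand :: nat
  n_supply :: nat
  demand_carry :: real
  supply_carry :: real
  reward :: "nat \<Rightarrow> nat \<Rightarrow> nat \<Rightarrow> real"  \<comment> \<open>period, demand type, supply type\<close>
  sample :: "'w measure"
  demand_arrival :: "nat \<Rightarrow> 'w \<Rightarrow> nat \<Rightarrow> real"
  supply_arrival :: "nat \<Rightarrow> 'w \<Rightarrow> nat \<Rightarrow> real"

text \<open>
  The demand and supply vectors of a period may be correlated. That arrivals do not depend on
  matching decisions is built into their being fixed random variables.
\<close>

definition is_matching_model :: "'w matching_model \<Rightarrow> bool" where
  "is_matching_model P \<longleftrightarrow>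
     horizon P \<ge> 1 \<and> n_demand P \<ge> 1 \<and> n_supply P \<ge> 1 \<and>
     demand_carry P \<in> {0..1} \<and> supply_carry P \<in> {0..1} \<and>
     prob_space (sample P) \<and>
     (\<forall>t\<in>{1..horizon P}.
        demand_arrival P t \<in> measurable (sample P) (orthant (n_demand P)) \<and>
        supply_arrival P t \<in> measurable (sample P) (orthant (n_supply P)) \<and>
        (\<forall>i\<in>{1..n_demand P}. integrable (sample P) (\<lambda>\<omega>. demand_arrival P t \<omega> i)) \<and>
        (\<forall>j\<in>{1..n_supply P}. integrable (sample P) (\<lambda>\<omega>. supply_arrival P t \<omega> j)))"

definition state_space :: "'w matching_model \<Rightarrow> state measure" where
  "state_space P = orthant (n_demand P) \<Otimes>\<^sub>M orthant (n_supply P)"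

definition demand_left :: "'w matching_model \<Rightarrow> state \<Rightarrow> decision \<Rightarrow> nat \<Rightarrow> real" where
  "demand_left P s Q i = fst s i - (\<Sum>j=1..n_supply P. Q i j)"

definition supply_left :: "'w matching_model \<Rightarrow> state \<Rightarrow> decision \<Rightarrow> nat \<Rightarrow> real" where
  "supply_left P s Q j = snd s j - (\<Sum>i=1..n_demand P. Q i j)"

definition feasible :: "'w matching_model \<Rightarrow> state \<Rightarrow> decision \<Rightarrow> bool" where
  "feasible P s Q \<longleftrightarrow>
     (\<forall>i\<in>{1..n_demand P}. \<forall>j\<in>{1..n_supply P}. Q i j \<ge> 0) \<and>
     (\<forall>i\<in>{1..n_demand P}. demand_left P s Q i \<ge> 0) \<and>
     (\<forall>j\<in>{1..n_supply P}. supply_left P s Q j \<ge> 0)"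

definition period_reward :: "'w matching_model \<Rightarrow> nat \<Rightarrow> decision \<Rightarrow> real" where
  "period_reward P t Q = (\<Sum>i=1..n_demand P. \<Sum>j=1..n_supply P. reward P t i j * Q i j)"

text \<open>The state in period \<open>t + 1\<close> after decision \<open>Q\<close> in state \<open>s\<close> of period \<open>t\<close>.\<close>

definition next_state :: "'w matching_model \<Rightarrow> nat \<Rightarrow> state \<Rightarrow> decision \<Rightarrow> 'w \<Rightarrow> state" where
  "next_state P t s Q \<omega> =
     ((\<lambda>i\<in>{1..n_demand P}. demand_carry P * demand_left P s Q i + demand_arrival P (t + 1) \<omega> i),
      (\<lambda>j\<in>{1..n_supply P}. supply_carry P * supply_left P s Q j + supply_arrival P (t + 1) \<omega> j))"

text \<open>
  Borel measurability is what makes the expectations in the total reward of a policy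
  well-defined; the integral of a non-measurable function is 0 by convention.
\<close>

definition is_policy :: "'w matching_model \<Rightarrow> policy \<Rightarrow> bool" where
  "is_policy P \<pi> \<longleftrightarrow>
     (\<forall>t\<in>{1..horizon P}.
        (\<forall>s\<in>space (state_space P). feasible P s (\<pi> t s)) \<and>
        (\<forall>i\<in>{1..n_demand P}. \<forall>j\<in>{1..n_supply P}.
           (\<lambda>s. \<pi> t s i j) \<in> borel_measurable (state_space P)))"

function total_reward :: "'w matching_model \<Rightarrow> policy \<Rightarrow> nat \<Rightarrow> state \<Rightarrow> real" where
  "total_reward P \<pi> t s =
     (if t > horizon P then 0
      else period_reward P t (\<pi> t s) +
           (\<integral>\<omega>. total_reward P \<pi> (t + 1) (next_state P t s (\<pi> t s) \<omega>) \<partial>sample P))"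
  by pat_completeness auto
termination
  by (relation "Wellfounded.measure (\<lambda>(P, \<pi>, t, s). Suc (horizon P) - t)") auto

declare total_reward.simps [simp del]

definition vertical_rewards ::
  "'w matching_model \<Rightarrow> (nat \<Rightarrow> nat \<Rightarrow> real) \<Rightarrow> (nat \<Rightarrow> nat \<Rightarrow> real) \<Rightarrow> bool" where
  "vertical_rewards P rd rs \<longleftrightarrow>
     (\<forall>t\<in>{1..horizon P}.
        (\<forall>i\<in>{1..n_demand P}. \<forall>j\<in>{1..n_supply P}. reward P t i j = rd t i + rs t j) \<and>
        (\<forall>i\<in>{1..<n_demand P}. rd t i > rd t (i + 1)) \<and>
        (\<forall>j\<in>{1..<n_supply P}. rs t j > rs t (j + 1)) \<and>
        rd t (n_demand P + 1) = 0 \<and> rs t (n_supply P + 1) = 0) \<and>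
     (\<forall>t\<in>{1..<horizon P}.
        (\<forall>i\<in>{1..n_demand P}.
           rd t i - rd t (i + 1) \<ge> demand_carry P * (rd (t + 1) i - rd (t + 1) (i + 1))) \<and>
        (\<forall>j\<in>{1..n_supply P}.
           rs t j - rs t (j + 1) \<ge> supply_carry P * (rs (t + 1) j - rs (t + 1) (j + 1))))"

definition cumulative :: "(nat \<Rightarrow> real) \<Rightarrow> nat \<Rightarrow> real" where
  "cumulative x i = (\<Sum>k=1..i. x k)"

definition greedy :: policy where
  "greedy t s i j =
     max 0 (min (cumulative (fst s) i) (cumulative (snd s) j)
            - max (cumulative (fst s) (i - 1)) (cumulative (snd s) (j - 1)))"

text \<open>The reward from period \<open>t\<close> on of using \<open>Q\<close> in period \<open>t\<close> and the greedy policy afterwards.\<close>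

definition lookahead_reward :: "'w matching_model \<Rightarrow> nat \<Rightarrow> state \<Rightarrow> decision \<Rightarrow> real" where
  "lookahead_reward P t s Q =
     period_reward P t Q +
     (\<integral>\<omega>. total_reward P greedy (t + 1) (next_state P t s Q \<omega>) \<partial>sample P)"

definition one_step_ahead :: "'w matching_model \<Rightarrow> policy \<Rightarrow> bool" where
  "one_step_ahead P \<pi> \<longleftrightarrow>
     is_policy P \<pi> \<and>
     (\<forall>t\<in>{1..horizon P}. \<forall>s\<in>space (state_space P).
        is_arg_max (lookahead_reward P t s) (feasible P s) (\<pi> t s))"

end

theory Submission imports Defs begin

text \<open>
  This is the policy improvement principle. Let \<open>W\<close> be the reward of the one-step-ahead policy
  and \<open>V\<close> that of the greedy policy. If \<open>W \<ge> V\<close> from period \<open>t + 1\<close> on, then in period \<open>t\<close> the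
  one-step-ahead policy earns at least what its own decision would earn if greedy were used
  afterwards (monotonicity of the expectation); this is the maximum of the lookahead reward over
  the feasible decisions (definition of the policy), hence at least the lookahead reward of the
  greedy decision, which is \<open>V\<close> in period \<open>t\<close>. Backward induction on \<open>t\<close> gives
  \<open>one_step_ahead_ge_greedy\<close>.

  Two points need an argument. The greedy decision must be feasible: it is the overlap of
  consecutive intervals on a line, and the overlaps of one interval with the pieces of a
  partition telescope (\<open>sum_interval_overlap\<close>). Monotonicity of the expectation requires
  integrability: a decision can match no more than the available demand, so rewards grow at most
  linearly in the total demand, and this bound, together with measurability, is inherited by the
  expected reward of every policy (\<open>tame_total_reward\<close>).
\<close>

section \<open>Feasibility of the greedy decision\<close>

lemma sum_interval_overlap:
  fixes Y :: "nat \<Rightarrow> real"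
  assumes "a \<le> b" and "mono_on {..n} Y"
  shows "(\<Sum>j=1..n. max 0 (min b (Y j) - max a (Y (j - 1)))) = max 0 (min b (Y n) - max a (Y 0))"
  using assms(2)
proof (induction n)
  case 0
  then show ?case using assms(1) by simp
next
  case (Suc n)
  have "mono_on {..n} Y" using Suc.prems by (rule mono_on_subset) auto
  moreover have "Y 0 \<le> Y n" "Y n \<le> Y (Suc n)"
    using Suc.prems by (auto simp: mono_on_def)
  ultimately show ?case using Suc.IH assms(1) by (auto simp: max_def min_def)
qed

lemma cumulative_0 [simp]: "cumulative x 0 = 0"
  by (simp add: cumulative_def)

lemma cumulative_step: "i \<ge> 1 \<Longrightarrow> cumulative x i = cumulative x (i - 1) + x i"
  by (cases i) (simp_all add: cumulative_def)

lemma mono_on_cumulative: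
  assumes "\<And>i. i \<in> {1..n} \<Longrightarrow> x i \<ge> 0"
  shows "mono_on {..n} (cumulative x)"
  unfolding cumulative_def
  by (rule mono_onI, rule sum_mono2) (use assms in auto)

text \<open>
  A demand type \<open>i\<close> occupies the interval from \<open>cumulative x (i - 1)\<close> to \<open>cumulative x i\<close>, whose
  length is \<open>x i\<close>; the greedy decision gives it its overlaps with the supply intervals.
\<close>

lemma sum_greedy_overlap_le:
  fixes x y :: "nat \<Rightarrow> real"
  assumes "i \<ge> 1" "x i \<ge> 0" and "\<And>j. j \<in> {1..n} \<Longrightarrow> y j \<ge> 0"
  shows "(\<Sum>j=1..n. max 0 (min (cumulative x i) (cumulative y j)
                     - max (cumulative x (i - 1)) (cumulative y (j - 1)))) \<le> x i"
proof -
  have step: "cumulative x i = cumulative x (i - 1) + x i"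
    using assms(1) by (rule cumulative_step)
  then have "cumulative x (i - 1) \<le> cumulative x i" using assms(2) by simp
  from sum_interval_overlap[OF this mono_on_cumulative[OF assms(3)]] show ?thesis
    using step assms(2) by (simp add: max_def min_def)
qed

lemma state_nonneg:
  assumes "s \<in> space (state_space P)"
  shows "i \<in> {1..n_demand P} \<Longrightarrow> fst s i \<ge> 0" and "j \<in> {1..n_supply P} \<Longrightarrow> snd s j \<ge> 0"
  using assms by (auto simp: state_space_def space_pair_measure space_orthant)

lemma feasible_greedy:
  assumes "s \<in> space (state_space P)"
  shows "feasible P s (greedy t s)"
proof -
  have "(\<Sum>j=1..n_supply P. greedy t s i j) \<le> fst s i" if "i \<in> {1..n_demand P}" for i
    unfolding greedy_def
    by (rule sum_greedy_overlap_le) (use that state_nonneg[OF assms] in auto)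
  moreover have "(\<Sum>i=1..n_demand P. greedy t s i j) \<le> snd s j" if "j \<in> {1..n_supply P}" for j
    using sum_greedy_overlap_le[of j "snd s" "n_demand P" "fst s"] that state_nonneg[OF assms]
    by (simp add: greedy_def min.commute max.commute)
  ultimately show ?thesis
    by (auto simp: feasible_def demand_left_def supply_left_def greedy_def)
qed

section \<open>Measurability of the greedy decision\<close>

lemma orthant_component:
  assumes "f \<in> measurable N (orthant k)" "i \<in> {1..k}"
  shows "(\<lambda>z. f z i) \<in> borel_measurable N"
proof -
  have "(\<lambda>z. f z i) \<in> measurable N (restrict_space borel {0..})"
    using assms(1)[unfolded orthant_def] measurable_component_singleton[OF assms(2)]
    by (rule measurable_compose)
  then show ?thesis by (simp add: measurable_restrict_space2_iff)
qed

lemma measurable_into_orthant: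
  assumes "\<And>i. i \<in> {1..k} \<Longrightarrow> (\<lambda>z. f z i) \<in> borel_measurable N"
    and "\<And>i z. i \<in> {1..k} \<Longrightarrow> z \<in> space N \<Longrightarrow> f z i \<ge> 0"
  shows "(\<lambda>z. \<lambda>i\<in>{1..k}. f z i) \<in> measurable N (orthant k)"
  unfolding orthant_def
  by (intro measurable_restrict measurable_restrict_space2) (use assms in auto)

lemma state_component_measurable:
  shows "i \<in> {1..n_demand P} \<Longrightarrow> (\<lambda>s. fst s i) \<in> borel_measurable (state_space P)"
    and "j \<in> {1..n_supply P} \<Longrightarrow> (\<lambda>s. snd s j) \<in> borel_measurable (state_space P)"
  unfolding state_space_def
  by (rule orthant_component[OF measurable_fst], simp)
    (rule orthant_component[OF measurable_snd], simp)

lemma is_policy_greedy: "is_policy P greedy"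
proof -
  have "(\<lambda>s. cumulative (fst s) i) \<in> borel_measurable (state_space P)" if "i \<le> n_demand P" for i
    unfolding cumulative_def
    by (intro borel_measurable_sum state_component_measurable) (use that in auto)
  moreover have "(\<lambda>s. cumulative (snd s) j) \<in> borel_measurable (state_space P)"
    if "j \<le> n_supply P" for j
    unfolding cumulative_def
    by (intro borel_measurable_sum state_component_measurable) (use that in auto)
  ultimately have "(\<lambda>s. greedy t s i j) \<in> borel_measurable (state_space P)"
    if "i \<in> {1..n_demand P}" "j \<in> {1..n_supply P}" for t i j
    unfolding greedy_def
    by (intro borel_measurable_max borel_measurable_min borel_measurable_diff borel_measurable_const)
      (use that in auto)
  then show ?thesis using feasible_greedy unfolding is_policy_def by blast
qed

section \<open>Integrability of the rewards\<close>

text \<open>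
  The bound is linear in the total demand because this class of functions is closed under taking
  the expectation over the next state: matching and carrying over never increase the demand, and
  the arrivals add an integrable amount.
\<close>

definition tame :: "'w matching_model \<Rightarrow> (state \<Rightarrow> real) \<Rightarrow> bool" where
  "tame P f \<longleftrightarrow>
     f \<in> borel_measurable (state_space P) \<and>
     (\<exists>A B. A \<ge> 0 \<and> B \<ge> 0 \<and>
        (\<forall>s\<in>space (state_space P). \<bar>f s\<bar> \<le> A + B * cumulative (fst s) (n_demand P)))"

lemma tame_zero: "tame P (\<lambda>s. 0)"
  unfolding tame_def by (auto intro!: exI[of _ 0])

lemma tame_add:
  assumes "tame P f" "tame P g"
  shows "tame P (\<lambda>s. f s + g s)"
proof -
  obtain A B A' B' where "A \<ge> 0" "B \<ge> 0" "A' \<ge> 0" "B' \<ge> 0"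
    and f: "\<And>s. s \<in> space (state_space P) \<Longrightarrow> \<bar>f s\<bar> \<le> A + B * cumulative (fst s) (n_demand P)"
    and g: "\<And>s. s \<in> space (state_space P) \<Longrightarrow> \<bar>g s\<bar> \<le> A' + B' * cumulative (fst s) (n_demand P)"
    using assms unfolding tame_def by metis
  have "\<bar>f s + g s\<bar> \<le> (A + A') + (B + B') * cumulative (fst s) (n_demand P)"
    if "s \<in> space (state_space P)" for s
    using f[OF that] g[OF that] by (simp add: distrib_right)
  moreover have "(\<lambda>s. f s + g s) \<in> borel_measurable (state_space P)"
    using assms unfolding tame_def by (intro borel_measurable_add) auto
  moreover have "0 \<le> A + A'" "0 \<le> B + B'"
    using \<open>A \<ge> 0\<close> \<open>B \<ge> 0\<close> \<open>A' \<ge> 0\<close> \<open>B' \<ge> 0\<close> by auto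
  ultimately show ?thesis unfolding tame_def by blast
qed

text \<open>No entry of a feasible decision can exceed the demand in its row.\<close>

lemma abs_period_reward_le:
  assumes "feasible P s Q"
  shows "\<bar>period_reward P t Q\<bar> \<le>
    (\<Sum>i=1..n_demand P. \<Sum>j=1..n_supply P. \<bar>reward P t i j\<bar>) * cumulative (fst s) (n_demand P)"
proof -
  have row: "(\<Sum>j=1..n_supply P. Q i j) \<le> fst s i" if "i \<in> {1..n_demand P}" for i
    using assms that by (auto simp: feasible_def demand_left_def)
  have entry_le: "Q i j \<le> (\<Sum>j=1..n_supply P. Q i j)"
    and Q_nonneg: "0 \<le> Q i j" if "i \<in> {1..n_demand P}" "j \<in> {1..n_supply P}" for i j
    using assms that unfolding feasible_def by (auto intro!: member_le_sum)
  have x_nonneg: "0 \<le> fst s i" if "i \<in> {1..n_demand P}" for i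
    using row[OF that] sum_nonneg[of "{1..n_supply P}" "Q i"] Q_nonneg[OF that] by force
  have x_le: "fst s i \<le> cumulative (fst s) (n_demand P)" if "i \<in> {1..n_demand P}" for i
    unfolding cumulative_def using that x_nonneg by (auto intro!: member_le_sum)
  have "\<bar>reward P t i j * Q i j\<bar> \<le> \<bar>reward P t i j\<bar> * cumulative (fst s) (n_demand P)"
    if "i \<in> {1..n_demand P}" "j \<in> {1..n_supply P}" for i j
    using entry_le[OF that] Q_nonneg[OF that] row[OF that(1)] x_le[OF that(1)]
    by (auto simp: abs_mult intro!: mult_left_mono)
  then show ?thesis
    unfolding period_reward_def sum_distrib_right
    by (intro order_trans[OF sum_abs] sum_mono order_trans[OF sum_abs]) auto
qed

lemma tame_period_reward:
  assumes "is_policy P \<pi>" "t \<in> {1..horizon P}"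
  shows "tame P (\<lambda>s. period_reward P t (\<pi> t s))"
proof -
  have "(\<lambda>s. period_reward P t (\<pi> t s)) \<in> borel_measurable (state_space P)"
    unfolding period_reward_def
    by (intro borel_measurable_sum borel_measurable_times borel_measurable_const)
      (use assms in \<open>auto simp: is_policy_def\<close>)
  moreover have "0 \<le> (\<Sum>i=1..n_demand P. \<Sum>j=1..n_supply P. \<bar>reward P t i j\<bar>)"
    by (intro sum_nonneg) auto
  moreover have "\<bar>period_reward P t (\<pi> t s)\<bar> \<le>
    0 + (\<Sum>i=1..n_demand P. \<Sum>j=1..n_supply P. \<bar>reward P t i j\<bar>) * cumulative (fst s) (n_demand P)"
    if "s \<in> space (state_space P)" for s
    using abs_period_reward_le[of P s "\<pi> t s" t] assms that by (auto simp: is_policy_def)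
  ultimately show ?thesis unfolding tame_def by blast
qed

lemma arrival_nonneg:
  assumes "is_matching_model P" "t \<in> {1..horizon P}" "\<omega> \<in> space (sample P)"
  shows "i \<in> {1..n_demand P} \<Longrightarrow> demand_arrival P t \<omega> i \<ge> 0"
    and "j \<in> {1..n_supply P} \<Longrightarrow> supply_arrival P t \<omega> j \<ge> 0"
proof -
  have "demand_arrival P t \<omega> \<in> space (orthant (n_demand P))"
    "supply_arrival P t \<omega> \<in> space (orthant (n_supply P))"
    using assms by (auto simp: is_matching_model_def dest: measurable_space)
  then show "i \<in> {1..n_demand P} \<Longrightarrow> demand_arrival P t \<omega> i \<ge> 0"
    and "j \<in> {1..n_supply P} \<Longrightarrow> supply_arrival P t \<omega> j \<ge> 0"
    by (auto simp: space_orthant)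
qed

lemma next_state_measurable:
  assumes P: "is_matching_model P" and \<pi>: "is_policy P \<pi>" and t: "t \<ge> 1" "t < horizon P"
  shows "(\<lambda>(s, \<omega>). next_state P t s (\<pi> t s) \<omega>)
           \<in> measurable (state_space P \<Otimes>\<^sub>M sample P) (state_space P)"
proof -
  let ?N = "state_space P \<Otimes>\<^sub>M sample P"
  have t': "t \<in> {1..horizon P}" "t + 1 \<in> {1..horizon P}" using t by auto
  have Q: "(\<lambda>z. \<pi> t (fst z) i j) \<in> borel_measurable ?N"
    if "i \<in> {1..n_demand P}" "j \<in> {1..n_supply P}" for i j
    using \<pi> t'(1) that by (auto simp: is_policy_def intro!: measurable_compose[OF measurable_fst])
  have arr: "(\<lambda>z. demand_arrival P (t + 1) (snd z)) \<in> measurable ?N (orthant (n_demand P))"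
    "(\<lambda>z. supply_arrival P (t + 1) (snd z)) \<in> measurable ?N (orthant (n_supply P))"
    using P t'(2) by (auto simp: is_matching_model_def intro!: measurable_compose[OF measurable_snd])
  have feas: "feasible P (fst z) (\<pi> t (fst z))" "snd z \<in> space (sample P)"
    if "z \<in> space ?N" for z
    using \<pi> t'(1) that by (auto simp: is_policy_def space_pair_measure)
  have carry: "demand_carry P \<ge> 0" "supply_carry P \<ge> 0"
    using P by (auto simp: is_matching_model_def)
  have "(\<lambda>z. \<lambda>i\<in>{1..n_demand P}. demand_carry P * demand_left P (fst z) (\<pi> t (fst z)) i
             + demand_arrival P (t + 1) (snd z) i) \<in> measurable ?N (orthant (n_demand P))"
  proof (rule measurable_into_orthant)
    fix i assume i: "i \<in> {1..n_demand P}"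
    show "(\<lambda>z. demand_carry P * demand_left P (fst z) (\<pi> t (fst z)) i
               + demand_arrival P (t + 1) (snd z) i) \<in> borel_measurable ?N"
      unfolding demand_left_def
      by (intro borel_measurable_add borel_measurable_times borel_measurable_const
          borel_measurable_diff borel_measurable_sum Q orthant_component[OF arr(1)] i
          measurable_compose[OF measurable_fst state_component_measurable(1)])
    show "0 \<le> demand_carry P * demand_left P (fst z) (\<pi> t (fst z)) i
               + demand_arrival P (t + 1) (snd z) i" if "z \<in> space ?N" for z
      using feas[OF that] carry i arrival_nonneg(1)[OF P t'(2)]
      by (intro add_nonneg_nonneg mult_nonneg_nonneg) (auto simp: feasible_def)
  qed
  moreover have "(\<lambda>z. \<lambda>j\<in>{1..n_supply P}. supply_carry P * supply_left P (fst z) (\<pi> t (fst z)) j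
             + supply_arrival P (t + 1) (snd z) j) \<in> measurable ?N (orthant (n_supply P))"
  proof (rule measurable_into_orthant)
    fix j assume j: "j \<in> {1..n_supply P}"
    show "(\<lambda>z. supply_carry P * supply_left P (fst z) (\<pi> t (fst z)) j
               + supply_arrival P (t + 1) (snd z) j) \<in> borel_measurable ?N"
      unfolding supply_left_def
      by (intro borel_measurable_add borel_measurable_times borel_measurable_const
          borel_measurable_diff borel_measurable_sum Q orthant_component[OF arr(2)] j
          measurable_compose[OF measurable_fst state_component_measurable(2)])
    show "0 \<le> supply_carry P * supply_left P (fst z) (\<pi> t (fst z)) j
               + supply_arrival P (t + 1) (snd z) j" if "z \<in> space ?N" for z
      using feas[OF that] carry j arrival_nonneg(2)[OF P t'(2)]
      by (intro add_nonneg_nonneg mult_nonneg_nonneg) (auto simp: feasible_def)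
  qed
  ultimately show ?thesis
    unfolding next_state_def split_beta state_space_def by (rule measurable_Pair)
qed

lemma next_state_in_space:
  assumes "is_matching_model P" "is_policy P \<pi>" "t \<ge> 1" "t < horizon P"
    and "s \<in> space (state_space P)" "\<omega> \<in> space (sample P)"
  shows "next_state P t s (\<pi> t s) \<omega> \<in> space (state_space P)"
  using measurable_space[OF next_state_measurable[OF assms(1-4)], of "(s, \<omega>)"] assms(5,6)
  by (simp add: space_pair_measure)

lemma next_state_demand_le:
  assumes "is_matching_model P" "feasible P s Q"
  shows "cumulative (fst (next_state P t s Q \<omega>)) (n_demand P)
    \<le> cumulative (fst s) (n_demand P) + cumulative (demand_arrival P (t + 1) \<omega>) (n_demand P)"
proof -
  have carry: "0 \<le> demand_carry P" "demand_carry P \<le> 1"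
    using assms(1) by (auto simp: is_matching_model_def)
  have "demand_carry P * demand_left P s Q i \<le> fst s i" if i: "i \<in> {1..n_demand P}" for i
  proof -
    have "demand_carry P * demand_left P s Q i \<le> demand_left P s Q i"
      using carry assms(2) i by (intro mult_left_le_one_le) (auto simp: feasible_def)
    also have "\<dots> \<le> fst s i"
      using assms(2) i unfolding demand_left_def feasible_def by (auto intro: sum_nonneg)
    finally show ?thesis .
  qed
  then show ?thesis
    unfolding cumulative_def sum.distrib[symmetric] next_state_def by (intro sum_mono) auto
qed

lemma integrable_demand_arrivals:
  assumes "is_matching_model P" "t \<in> {1..horizon P}"
  shows "integrable (sample P) (\<lambda>\<omega>. cumulative (demand_arrival P t \<omega>) (n_demand P))"
  unfolding cumulative_def using assms by (auto simp: is_matching_model_def)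

context
  fixes P :: "'w matching_model" and \<pi> :: policy and t :: nat and f :: "state \<Rightarrow> real"
  assumes P: "is_matching_model P" and \<pi>: "is_policy P \<pi>"
    and t: "t \<ge> 1" "t < horizon P" and f: "tame P f"
begin

lemma next_period_measurable:
  "(\<lambda>(s, \<omega>). f (next_state P t s (\<pi> t s) \<omega>)) \<in> borel_measurable (state_space P \<Otimes>\<^sub>M sample P)"
  using measurable_compose[OF next_state_measurable[OF P \<pi> t], of f borel] f
  by (simp add: tame_def split_beta)

lemma next_period_bound:
  obtains A B where "A \<ge> 0" "B \<ge> 0"
    and "\<And>s \<omega>. s \<in> space (state_space P) \<Longrightarrow> \<omega> \<in> space (sample P) \<Longrightarrow>
      \<bar>f (next_state P t s (\<pi> t s) \<omega>)\<bar> \<le> A + B * (cumulative (fst s) (n_demand P)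
         + cumulative (demand_arrival P (t + 1) \<omega>) (n_demand P))"
proof -
  obtain A B where AB: "A \<ge> 0" "B \<ge> 0"
    and bound: "\<And>s. s \<in> space (state_space P) \<Longrightarrow> \<bar>f s\<bar> \<le> A + B * cumulative (fst s) (n_demand P)"
    using f unfolding tame_def by metis
  show ?thesis
  proof (rule that[OF AB])
    fix s \<omega> assume s: "s \<in> space (state_space P)" and \<omega>: "\<omega> \<in> space (sample P)"
    have "feasible P s (\<pi> t s)" using \<pi> s t by (auto simp: is_policy_def)
    from mult_left_mono[OF next_state_demand_le[OF P this] AB(2)]
      bound[OF next_state_in_space[OF P \<pi> t s \<omega>]]
    show "\<bar>f (next_state P t s (\<pi> t s) \<omega>)\<bar> \<le> A + B * (cumulative (fst s) (n_demand P)
         + cumulative (demand_arrival P (t + 1) \<omega>) (n_demand P))"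
      by (meson add_left_mono order_trans)
  qed
qed

lemma integrable_next_period:
  assumes s: "s \<in> space (state_space P)"
  shows "integrable (sample P) (\<lambda>\<omega>. f (next_state P t s (\<pi> t s) \<omega>))"
proof -
  interpret prob_space "sample P" using P by (simp add: is_matching_model_def)
  obtain A B where bound: "\<And>s \<omega>. s \<in> space (state_space P) \<Longrightarrow> \<omega> \<in> space (sample P) \<Longrightarrow>
      \<bar>f (next_state P t s (\<pi> t s) \<omega>)\<bar> \<le> A + B * (cumulative (fst s) (n_demand P)
         + cumulative (demand_arrival P (t + 1) \<omega>) (n_demand P))"
    using next_period_bound by metis
  show ?thesis
  proof (rule Bochner_Integration.integrable_bound)
    show "integrable (sample P) (\<lambda>\<omega>. A + B * (cumulative (fst s) (n_demand P)
            + cumulative (demand_arrival P (t + 1) \<omega>) (n_demand P)))"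
      using integrable_demand_arrivals[OF P, of "t + 1"] t by auto
    show "(\<lambda>\<omega>. f (next_state P t s (\<pi> t s) \<omega>)) \<in> borel_measurable (sample P)"
      using measurable_compose[OF measurable_Pair1'[OF s] next_period_measurable] by simp
    show "AE \<omega> in sample P. norm (f (next_state P t s (\<pi> t s) \<omega>)) \<le> norm (A + B *
        (cumulative (fst s) (n_demand P) + cumulative (demand_arrival P (t + 1) \<omega>) (n_demand P)))"
      using bound[OF s] by (intro AE_I2) fastforce
  qed
qed

lemma tame_next_period:
  "tame P (\<lambda>s. \<integral>\<omega>. f (next_state P t s (\<pi> t s) \<omega>) \<partial>sample P)"
proof -
  interpret prob_space "sample P" using P by (simp add: is_matching_model_def)
  let ?D = "\<lambda>\<omega>. cumulative (demand_arrival P (t + 1) \<omega>) (n_demand P)"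
  have D: "integrable (sample P) ?D"
    using integrable_demand_arrivals[OF P, of "t + 1"] t by auto
  have D_nonneg: "0 \<le> (\<integral>\<omega>. ?D \<omega> \<partial>sample P)"
    unfolding cumulative_def
    by (intro Bochner_Integration.integral_nonneg_AE AE_I2 sum_nonneg arrival_nonneg(1)[OF P])
      (use t in auto)
  obtain A B where AB: "A \<ge> 0" "B \<ge> 0"
    and bound: "\<And>s \<omega>. s \<in> space (state_space P) \<Longrightarrow> \<omega> \<in> space (sample P) \<Longrightarrow>
      \<bar>f (next_state P t s (\<pi> t s) \<omega>)\<bar> \<le> A + B * (cumulative (fst s) (n_demand P) + ?D \<omega>)"
    using next_period_bound by metis
  have "\<bar>\<integral>\<omega>. f (next_state P t s (\<pi> t s) \<omega>) \<partial>sample P\<bar>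
    \<le> (A + B * (\<integral>\<omega>. ?D \<omega> \<partial>sample P)) + B * cumulative (fst s) (n_demand P)"
    if s: "s \<in> space (state_space P)" for s
  proof -
    have "\<bar>\<integral>\<omega>. f (next_state P t s (\<pi> t s) \<omega>) \<partial>sample P\<bar>
      \<le> (\<integral>\<omega>. \<bar>f (next_state P t s (\<pi> t s) \<omega>)\<bar> \<partial>sample P)"
      by (rule integral_abs_bound)
    also have "\<dots> \<le> (\<integral>\<omega>. A + B * (cumulative (fst s) (n_demand P) + ?D \<omega>) \<partial>sample P)"
      using integrable_next_period[OF s] D bound[OF s] by (intro integral_mono) auto
    also have "\<dots> = (A + B * (\<integral>\<omega>. ?D \<omega> \<partial>sample P)) + B * cumulative (fst s) (n_demand P)"
      using D by (simp add: prob_space algebra_simps)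
    finally show ?thesis .
  qed
  moreover have "0 \<le> A + B * (\<integral>\<omega>. ?D \<omega> \<partial>sample P)" using AB D_nonneg by simp
  moreover have "(\<lambda>s. \<integral>\<omega>. f (next_state P t s (\<pi> t s) \<omega>) \<partial>sample P)
      \<in> borel_measurable (state_space P)"
    using next_period_measurable by (rule borel_measurable_lebesgue_integral)
  ultimately show ?thesis using AB(2) unfolding tame_def by blast
qed

end

lemma total_reward_beyond_horizon: "t > horizon P \<Longrightarrow> total_reward P \<pi> t = (\<lambda>s. 0)"
  by (rule ext) (simp add: total_reward.simps)

lemma total_reward_step:
  assumes "t \<le> horizon P"
  shows "total_reward P \<pi> t = (\<lambda>s. period_reward P t (\<pi> t s) +
           (\<integral>\<omega>. total_reward P \<pi> (t + 1) (next_state P t s (\<pi> t s) \<omega>) \<partial>sample P))"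
  by (rule ext, subst total_reward.simps) (use assms in simp)

lemma tame_total_reward:
  assumes "is_matching_model P" "is_policy P \<pi>" "t \<ge> 1"
  shows "tame P (total_reward P \<pi> t)"
  using assms(3)
proof (induction "Suc (horizon P) - t" arbitrary: t)
  case 0
  then show ?case by (simp add: total_reward_beyond_horizon tame_zero)
next
  case (Suc d)
  then have t: "1 \<le> t" "t \<le> horizon P" by auto
  have "tame P (\<lambda>s. \<integral>\<omega>. total_reward P \<pi> (t + 1) (next_state P t s (\<pi> t s) \<omega>) \<partial>sample P)"
  proof (cases "t = horizon P")
    case True
    then show ?thesis by (simp add: total_reward_beyond_horizon tame_zero)
  next
    case False
    have "tame P (total_reward P \<pi> (t + 1))" using Suc.hyps t by simp
    then show ?thesis using False t by (intro tame_next_period[OF assms(1,2)]) auto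
  qed
  then show ?case
    unfolding total_reward_step[OF t(2)] using t
    by (intro tame_add tame_period_reward[OF assms(2)]) auto
qed

section \<open>Policy improvement\<close>

lemma lookahead_reward_greedy:
  "t \<le> horizon P \<Longrightarrow> lookahead_reward P t s (greedy t s) = total_reward P greedy t s"
  by (simp add: lookahead_reward_def total_reward_step)

text \<open>
  The induction compares the two policies in every state, because the comparison of the next
  period is used at whatever random state the current decision leads to.
\<close>

lemma one_step_ahead_ge_greedy:
  assumes P: "is_matching_model P" and \<pi>: "one_step_ahead P \<pi>"
    and "t \<ge> 1" and "s \<in> space (state_space P)"
  shows "total_reward P greedy t s \<le> total_reward P \<pi> t s"
  using assms(3,4)
proof (induction "Suc (horizon P) - t" arbitrary: t s)
  case 0
  then show ?case by (simp add: total_reward_beyond_horizon)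
next
  case (Suc d)
  then have t: "1 \<le> t" "t \<le> horizon P" and s: "s \<in> space (state_space P)" by auto
  have policy: "is_policy P \<pi>"
    and best: "is_arg_max (lookahead_reward P t s) (feasible P s) (\<pi> t s)"
    using \<pi> t s by (auto simp: one_step_ahead_def)
  have later: "(\<integral>\<omega>. total_reward P greedy (t + 1) (next_state P t s (\<pi> t s) \<omega>) \<partial>sample P)
    \<le> (\<integral>\<omega>. total_reward P \<pi> (t + 1) (next_state P t s (\<pi> t s) \<omega>) \<partial>sample P)"
  proof (cases "t = horizon P")
    case True
    then show ?thesis by (simp add: total_reward_beyond_horizon)
  next
    case False
    then have t': "t < horizon P" using t by simp
    show ?thesis
    proof (rule integral_mono)
      show "integrable (sample P)
              (\<lambda>\<omega>. total_reward P greedy (t + 1) (next_state P t s (\<pi> t s) \<omega>))"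
        by (intro integrable_next_period[OF P policy t(1) t' _ s]
            tame_total_reward[OF P is_policy_greedy]) simp
      show "integrable (sample P) (\<lambda>\<omega>. total_reward P \<pi> (t + 1) (next_state P t s (\<pi> t s) \<omega>))"
        by (intro integrable_next_period[OF P policy t(1) t' _ s]
            tame_total_reward[OF P policy]) simp
      show "total_reward P greedy (t + 1) (next_state P t s (\<pi> t s) \<omega>)
          \<le> total_reward P \<pi> (t + 1) (next_state P t s (\<pi> t s) \<omega>)"
        if "\<omega> \<in> space (sample P)" for \<omega>
        using Suc.hyps(2) t
        by (intro Suc.hyps(1) next_state_in_space[OF P policy t(1) t' s that]) auto
    qed
  qed
  have "total_reward P greedy t s = lookahead_reward P t s (greedy t s)"
    using t by (simp add: lookahead_reward_greedy)
  also have "\<dots> \<le> lookahead_reward P t s (\<pi> t s)"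
    using best feasible_greedy[OF s] by (auto simp: is_arg_max_linorder)
  also have "\<dots> \<le> total_reward P \<pi> t s"
    using later t by (simp add: lookahead_reward_def total_reward_step)
  finally show ?case .
qed

theorem proposition9:
  fixes P :: "'w matching_model"
    and rd rs :: "nat \<Rightarrow> nat \<Rightarrow> real"
    and \<pi> :: policy
    and s :: state
  assumes "is_matching_model P"
    and "vertical_rewards P rd rs"
    and "one_step_ahead P \<pi>"
    and "s \<in> space (state_space P)"
  shows "total_reward P \<pi> 1 s \<ge> total_reward P greedy 1 s"
  using one_step_ahead_ge_greedy[OF assms(1,3) _ assms(4)] by simp

end
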